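(* Let $X=X_1\oplus\cdots\oplus X_n$ be an Asplund space. Let $G\subseteq X$ be open and $f:G\to\mathbb R$ a locally Lipschitz function. Suppose that for each $1\le i\le n$ there exists a dense set $D_i\subseteq S_{X_i}$ such that for each $v\in D_i$, $f$ is essentially smooth on a generic line parallel to $v$. Then $f$ is generically Fr\'echet differentiable on $G$.
   Context: $X=X_1\oplus\cdots\oplus X_n$ means $X$ is the direct sum of non-trivial closed linear subspaces $X_1,\ldots,X_n$ and the corresponding projections are continuous. $S_{X_i}$ is the unit sphere of $X_i$. A Banach space is Asplund if every continuous convex real function on it is Fr\'echet differentiable outside a first category set (equivalently, every separable subspace has separable dual). $f$ is generically Fr\'echet differentiable on $G$ if the set of points where $f$ is Fr\'echet differentiable is residual in $G$. A real function $\phi$ on an open subset of a Banach space is strictly differentiable at $a$ if there is $x^*\in X^*$ with $\lim_{(x,y)\to(a,a),x\ne y}\frac{\phi(y)-\phi(x)-x^*(y-x)}{\|y-x\|}=0$. $f$ is essentially smooth on the line $L=a+\mathbb Rv$ ($v\ne0$) if the function $t\mapsto f(a+tv)$ (defined on $\{t: a+tv\in G\}$) is strictly differentiable at almost every point of its domain (Lebesgue measure); this does not depend on the choice of $a,v$. $f$ is essentially smooth on a generic line parallel to $v\ne0$ if $f$ is essentially smooth on all lines $a+\mathbb Rv$ except for a first category set of lines in the quotient space $X/\operatorname{span}\{v\}$. *)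

theory Defs
  imports "HOL-Analysis.Analysis"
begin

definition nowhere_dense :: "'a::topological_space set \<Rightarrow> bool" where
  "nowhere_dense A \<longleftrightarrow> interior (closure A) = {}"

definition first_category :: "'a::topological_space set \<Rightarrow> bool" where
  "first_category A \<longleftrightarrow> (\<exists>F :: nat \<Rightarrow> 'a set. (\<forall>k. nowhere_dense (F k)) \<and> A \<subseteq> (\<Union>k. F k))"

definition residual_in :: "'a::topological_space set \<Rightarrow> 'a set \<Rightarrow> bool" where
  "residual_in S G \<longleftrightarrow> first_category (G - S)"

definition direct_sum_decomp :: "nat \<Rightarrow> (nat \<Rightarrow> 'a::real_normed_vector set) \<Rightarrow> bool" where
  "direct_sum_decomp n Xs \<longleftrightarrow>
     (\<forall>i\<in>{1..n}. subspace (Xs i) \<and> closed (Xs i) \<and> Xs i \<noteq> {0}) \<and>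
     (\<forall>y. (\<forall>i\<in>{1..n}. y i \<in> Xs i) \<and> (\<Sum>i=1..n. y i) = 0 \<longrightarrow> (\<forall>i\<in>{1..n}. y i = 0)) \<and>
     (\<exists>P :: nat \<Rightarrow> 'a \<Rightarrow> 'a. (\<forall>i\<in>{1..n}. bounded_linear (P i) \<and> (\<forall>x. P i x \<in> Xs i)) \<and>
        (\<forall>x. x = (\<Sum>i=1..n. P i x)))"

definition asplund :: "'a::banach itself \<Rightarrow> bool" where
  "asplund _ \<longleftrightarrow> (\<forall>g :: 'a \<Rightarrow> real. convex_on UNIV g \<and> continuous_on UNIV g \<longrightarrow>
      first_category {x. \<not> g differentiable (at x)})"

definition locally_lipschitz_on :: "'a::metric_space set \<Rightarrow> ('a \<Rightarrow> real) \<Rightarrow> bool" where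
  "locally_lipschitz_on G f \<longleftrightarrow>
     (\<forall>x\<in>G. \<exists>r>0. \<exists>K. \<forall>y\<in>ball x r \<inter> G. \<forall>z\<in>ball x r \<inter> G. \<bar>f y - f z\<bar> \<le> K * dist y z)"

definition strictly_differentiable_at ::
    "('a::real_normed_vector \<Rightarrow> real) \<Rightarrow> 'a set \<Rightarrow> 'a \<Rightarrow> bool" where
  "strictly_differentiable_at phi U a \<longleftrightarrow> a \<in> U \<and>
     (\<exists>L. bounded_linear L \<and>
        (\<forall>e>0. \<exists>d>0. \<forall>x\<in>U. \<forall>y\<in>U. x \<in> ball a d \<and> y \<in> ball a d \<and> x \<noteq> y \<longrightarrow>
            \<bar>phi y - phi x - L (y - x)\<bar> \<le> e * norm (y - x)))"

definition ess_smooth_on_line ::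
    "('a::real_normed_vector \<Rightarrow> real) \<Rightarrow> 'a set \<Rightarrow> 'a \<Rightarrow> 'a \<Rightarrow> bool" where
  "ess_smooth_on_line f G a v \<longleftrightarrow>
     (let T = {t::real. a + t *\<^sub>R v \<in> G} in
       {t \<in> T. \<not> strictly_differentiable_at (\<lambda>s. f (a + s *\<^sub>R v)) T t} \<in> null_sets lebesgue)"

text \<open>f is essentially smooth on a generic line parallel to v: the lines a + R v on which
  f is not essentially smooth form a first category set.  Lines parallel to v are the
  fibres of the quotient map X \<rightarrow> X/span{v}; we express first category of a set of lines
  through first category of its union (its preimage in X).\<close>
definition ess_smooth_generic_lines ::
    "('a::real_normed_vector \<Rightarrow> real) \<Rightarrow> 'a set \<Rightarrow> 'a \<Rightarrow> bool" where
  "ess_smooth_generic_lines f G v \<longleftrightarrow> first_category {a. \<not> ess_smooth_on_line f G a v}"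

end

theory Submission
  imports Defs
begin

text \<open>Write $p_U(v)$ for the supremum of the difference quotients of $f$ in direction $v$ along segments
  inside an open convex set $U$ on which $f$ is Lipschitz. Splitting segments into short pieces shows that
  $p_U$ is sublinear. If $f$ is essentially smooth on generic lines parallel to $v$ and $c < p_U(v)$,
  then every line of an open family carries a short interval on which all quotients are at least $c$,
  and by Baire's theorem some such interval works for a nonempty open set of lines; hence all
  quotients in direction $v$ are at least $c$ on some smaller open $V$. By density this extends to every
  direction in $X_i$.

  Let $P$ be the projection onto $X_i$. As $X$ is Asplund, the convex function $p_U \<circ> P$ has a point
  $x_0$ of Frechet differentiability, with derivative $L$ say. Choosing $V$ for the direction $P x_0$ and
  $c$ close to $p_U(P x_0)$, sublinearity gives $p_V(P h) \<le> p_U(P (x_0 + h)) - c$, and hence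
  $p_V(P h) \<le> L h + \<epsilon> \<parallel>h\<parallel>$ for all $h$. Shrinking $V$ successively for
  $i = 1, \<dots>, n$ and adding up, $f$ is $\<epsilon>$-close to linear on a nonempty open subset of any
  given open subset of $G$. Points that have such a neighbourhood for every $\<epsilon>$ form a residual set.\<close>

section \<open>Baire category\<close>

text \<open>Otherwise \<open>U\<close> would lie in a countable union of closed sets with empty
  interior: the closures of the members of \<open>\<C>\<close> and of the nowhere dense sets that
  cover \<open>A\<close>. The set \<open>A\<close> will collect the base points of exceptional
  lines, and \<open>\<C>\<close> the candidate sets from which one has to be selected.\<close>

lemma open_not_covered_by_nowhere_dense:
  fixes U :: "'a::complete_space set"
  assumes "open U" "U \<noteq> {}" "first_category A" "countable \<C>" "U \<subseteq> A \<union> \<Union>\<C>"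
  obtains E where "E \<in> \<C>" "\<not> nowhere_dense E"
proof -
  obtain F :: "nat \<Rightarrow> 'a set" where F: "\<And>k. nowhere_dense (F k)" "A \<subseteq> (\<Union>k. F k)"
    using assms(3) unfolding first_category_def by blast
  have "\<exists>E\<in>\<C>. \<not> nowhere_dense E"
  proof (rule ccontr)
    assume "\<not> ?thesis"
    then have nd: "nowhere_dense E" if "E \<in> \<C> \<union> range F" for E
      using that F by blast
    let ?G = "closure ` (\<C> \<union> range F)"
    have "euclidean interior_of \<Union>?G = {}"
    proof (rule Baire_category_alt)
      show "completely_metrizable_space (euclidean :: 'a topology) \<or>
          locally_compact_space (euclidean :: 'a topology) \<and> regular_space (euclidean :: 'a topology)"
        by (simp add: completely_metrizable_space_euclidean)
      show "countable ?G" using assms(4) by simp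
      show "closedin euclidean T \<and> euclidean interior_of T = {}" if "T \<in> ?G" for T
        using that nd unfolding nowhere_dense_def by auto
    qed
    moreover have "U \<subseteq> \<Union>?G"
    proof
      fix x assume "x \<in> U"
      then obtain E where "E \<in> \<C> \<union> range F" "x \<in> E" using assms(5) F(2) by blast
      then show "x \<in> \<Union>?G" using closure_subset[of E] by blast
    qed
    ultimately show False
      using assms(1,2) by (metis interior_maximal euclidean_interior_of subset_empty)
  qed
  then show ?thesis using that by blast
qed

section \<open>Strict differentiability almost everywhere on an interval\<close>

text \<open>If no such interval existed, every strict derivative at a point of \<open>{a..b}\<close>
  would be at most \<open>c\<close>, so short increments around these points would have slope at
  most a fixed \<open>c'\<close> below the mean slope. The exceptional points lie in an open set of
  tiny measure, where the Lipschitz bound prevents them from making up the missing increase.\<close>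

lemma strictly_differentiable_ae_steep_interval:
  fixes \<phi> :: "real \<Rightarrow> real"
  assumes T: "open T" "{a..b} \<subseteq> T" and ab: "a < b"
    and lip: "\<And>x y. x \<in> {a..b} \<Longrightarrow> y \<in> {a..b} \<Longrightarrow> \<bar>\<phi> y - \<phi> x\<bar> \<le> K * \<bar>y - x\<bar>"
    and null: "{t \<in> T. \<not> strictly_differentiable_at \<phi> T t} \<in> null_sets lebesgue"
    and steep: "c * (b - a) < \<phi> b - \<phi> a"
  obtains z d where "z \<in> {a..b}" "d > 0"
    "\<And>x y. z - d < x \<Longrightarrow> x < y \<Longrightarrow> y < z + d \<Longrightarrow> c * (y - x) \<le> \<phi> y - \<phi> x"
proof -
  define N where "N = {t \<in> T. \<not> strictly_differentiable_at \<phi> T t}"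
  have "c < (\<phi> b - \<phi> a) / (b - a)" using steep ab by (simp add: field_simps)
  \<comment> \<open>The gap from \<open>c\<close> to \<open>c'\<close> absorbs the error in strict
    differentiability; the gap from \<open>c'\<close> to the mean slope leaves a positive excess to
    be contradicted.\<close>
  then obtain c' where c': "c < c'" "c' < (\<phi> b - \<phi> a) / (b - a)" using dense by blast
  then have c'2: "c' * (b - a) < \<phi> b - \<phi> a" using ab by (simp add: field_simps)
  \<comment> \<open>\<open>M\<close> is large enough for \<open>K \<le> c' + M\<close>. The excess
    over slope \<open>c'\<close> would then need exceptional intervals of total length at least
    \<open>e\<close>, so \<open>O'\<close> is chosen with measure below \<open>e\<close>.\<close>
  define M where "M = \<bar>K\<bar> + \<bar>c'\<bar> + 1"
  have M: "M > 0" unfolding M_def by simp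
  define e where "e = (\<phi> b - \<phi> a - c' * (b - a)) / M"
  have e: "e > 0" unfolding e_def using M c'2 by simp
  obtain O' where O: "open O'" "N \<subseteq> O'" "O' - N \<in> lmeasurable" "emeasure lebesgue (O' - N) < ennreal e"
    using sets_lebesgue_outer_open[of N e] null e unfolding N_def by blast
  have Nnull: "N \<in> null_sets lebesgue" using null N_def by simp
  have Oset: "O' \<in> sets lebesgue" using O(1) by simp
  have Oem: "emeasure lebesgue O' < ennreal e"
    using O(4) emeasure_Diff_null_set[OF Nnull Oset] by simp
  have Olm: "O' \<in> lmeasurable"
    using Oset Oem by (simp add: fmeasurable_def order_less_trans[OF _ ennreal_less_top])
  have Om: "measure lebesgue O' < e"
    using Oem Olm e by (simp add: emeasure_eq_measure2 ennreal_less_iff)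
  \<comment> \<open>Half-open intervals make \<open>m\<close> exactly additive over adjacent
    intervals, as the subdivision argument below requires.\<close>
  define m where "m x y = measure lebesgue (O' \<inter> {x<..y})" for x y
  have lm: "O' \<inter> {x<..y} \<in> lmeasurable" for x y
    using Olm by (rule fmeasurable_Int_fmeasurable) simp
  have m_add: "m x z = m x y + m y z" if "x \<le> y" "y \<le> z" for x y z
  proof -
    have "O' \<inter> {x<..z} = (O' \<inter> {x<..y}) \<union> (O' \<inter> {y<..z})" using that by auto
    moreover have "(O' \<inter> {x<..y}) \<inter> (O' \<inter> {y<..z}) = {}" by auto
    ultimately show ?thesis unfolding m_def
      using lm by (metis measure_Un2 lm Diff_triv Int_commute)
  qed
  show ?thesis
  proof (rule ccontr)
    assume "\<not> thesis"
    note none = that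
    \<comment> \<open>Around an exceptional point slopes exceed \<open>c'\<close> by at most \<open>M\<close>, but there the whole interval
      lies in the small open set \<open>O'\<close>, so the excess is paid for by its measure.\<close>
    have loc: "\<exists>d>0. \<forall>u w. u \<le> x \<and> x \<le> w \<and> w - u < d \<longrightarrow>
        (a \<le> u \<and> w \<le> b \<longrightarrow> \<phi> w - \<phi> u \<le> c' * (w - u) + M * m u w)" if x: "a \<le> x" "x \<le> b" for x
    proof (cases "x \<in> N")
      case True
      then obtain d where d: "d > 0" "ball x d \<subseteq> O'" using O(1,2) openE by blast
      show ?thesis
      proof (intro exI[of _ d] conjI allI impI)
        fix u w assume uw: "u \<le> x \<and> x \<le> w \<and> w - u < d" "a \<le> u \<and> w \<le> b"
        then have "{u<..w} \<subseteq> ball x d" by (auto simp: dist_real_def)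
        then have "O' \<inter> {u<..w} = {u<..w}" using d by blast
        then have mm: "m u w = w - u" unfolding m_def using uw by simp
        have "\<phi> w - \<phi> u \<le> K * (w - u)" using lip[of u w] uw by auto
        also have "\<dots> \<le> (c' + M) * (w - u)"
          by (rule mult_right_mono) (use uw in \<open>auto simp: M_def\<close>)
        finally show "\<phi> w - \<phi> u \<le> c' * (w - u) + M * m u w" unfolding mm distrib_right .
      qed (use d in auto)
    next
      case False
      have xT: "x \<in> T" using x T by auto
      then have "strictly_differentiable_at \<phi> T x" using False N_def by blast
      then obtain L where L: "bounded_linear L"
        "\<And>e. e > 0 \<Longrightarrow> \<exists>d>0. \<forall>u\<in>T. \<forall>w\<in>T. u \<in> ball x d \<and> w \<in> ball x d \<and> u \<noteq> w \<longrightarrow>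
            \<bar>\<phi> w - \<phi> u - L (w - u)\<bar> \<le> e * norm (w - u)"
        unfolding strictly_differentiable_at_def by blast
      define l where "l = L 1"
      have Ll: "L h = l * h" for h
        using linear_scale[OF bounded_linear.linear[OF L(1)], of h 1] unfolding l_def by simp
      obtain r where r: "r > 0" "ball x r \<subseteq> T" using T xT openE by blast
      have sd: "\<exists>d>0. \<forall>u w. u \<in> ball x d \<and> w \<in> ball x d \<and> u < w \<longrightarrow>
          (l - \<epsilon>) * (w - u) \<le> \<phi> w - \<phi> u \<and> \<phi> w - \<phi> u \<le> (l + \<epsilon>) * (w - u)" if \<epsilon>: "\<epsilon> > 0" for \<epsilon>
      proof -
        obtain d where d: "d > 0" "\<And>u w. u \<in> T \<Longrightarrow> w \<in> T \<Longrightarrow> u \<in> ball x d \<Longrightarrow> w \<in> ball x d \<Longrightarrow> u \<noteq> w \<Longrightarrow>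
            \<bar>\<phi> w - \<phi> u - L (w - u)\<bar> \<le> \<epsilon> * norm (w - u)" using L(2)[OF \<epsilon>] by blast
        show ?thesis
        proof (intro exI[of _ "min d r"] conjI allI impI; (elim conjE)?)
          fix u w assume uw: "u \<in> ball x (min d r)" "w \<in> ball x (min d r)" "u < w"
          then have "\<bar>\<phi> w - \<phi> u - l * (w - u)\<bar> \<le> \<epsilon> * (w - u)"
            using d(2)[of u w] r(2) by (auto simp: Ll subset_iff)
          then show "(l - \<epsilon>) * (w - u) \<le> \<phi> w - \<phi> u" "\<phi> w - \<phi> u \<le> (l + \<epsilon>) * (w - u)"
            unfolding left_diff_distrib distrib_right by linarith+
        qed (use d r in auto)
      qed
      have "l \<le> c"
      proof (rule ccontr)
        assume "\<not> l \<le> c"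
        then have "l - c > 0" by simp
        from sd[OF this] obtain d where d: "d > 0" "\<And>u w. u \<in> ball x d \<Longrightarrow> w \<in> ball x d \<Longrightarrow> u < w \<Longrightarrow>
          c * (w - u) \<le> \<phi> w - \<phi> u" by auto
        have thesis
          by (rule none[of x d]) (use x d in \<open>auto simp: dist_real_def\<close>)
        then show False using \<open>\<not> thesis\<close> by simp
      qed
      obtain d where d: "d > 0" "\<And>u w. u \<in> ball x d \<Longrightarrow> w \<in> ball x d \<Longrightarrow> u < w \<Longrightarrow>
          \<phi> w - \<phi> u \<le> (l + (c' - c)) * (w - u)" using sd[of "c' - c"] c' by auto
      show ?thesis
      proof (intro exI[of _ d] conjI allI impI)
        fix u w assume uw: "u \<le> x \<and> x \<le> w \<and> w - u < d"
        have m0: "0 \<le> M * m u w" using M unfolding m_def by simp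
        show "\<phi> w - \<phi> u \<le> c' * (w - u) + M * m u w"
        proof (cases "u < w")
          case True
          then have "\<phi> w - \<phi> u \<le> (l + (c' - c)) * (w - u)"
            using d(2)[of u w] uw by (auto simp: dist_real_def)
          also have "\<dots> \<le> c' * (w - u)"
            by (rule mult_right_mono) (use True \<open>l \<le> c\<close> in auto)
          finally show ?thesis using m0 by simp
        next
          case False then have "u = w" using uw by simp
          then show ?thesis using m0 by simp
        qed
      qed (use d in auto)
    qed
    \<comment> \<open>Subdivision also considers short intervals that stick out of
      \<open>{a..b}\<close>, where no Lipschitz bound is available; the guard on the endpoints makes
      the property vacuous for them.\<close>
    have "a \<le> a \<and> b \<le> b \<longrightarrow> \<phi> b - \<phi> a \<le> c' * (b - a) + M * m a b"
    proof (rule Bolzano[of a b "\<lambda>u w. a \<le> u \<and> w \<le> b \<longrightarrow> \<phi> w - \<phi> u \<le> c' * (w - u) + M * m u w"])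
      fix u v w assume *: "a \<le> u \<and> v \<le> b \<longrightarrow> \<phi> v - \<phi> u \<le> c' * (v - u) + M * m u v"
        "a \<le> v \<and> w \<le> b \<longrightarrow> \<phi> w - \<phi> v \<le> c' * (w - v) + M * m v w" "u \<le> v" "v \<le> w"
      show "a \<le> u \<and> w \<le> b \<longrightarrow> \<phi> w - \<phi> u \<le> c' * (w - u) + M * m u w"
        using * m_add[of u v w] by (auto simp: algebra_simps)
    qed (use ab loc in auto)
    moreover have "m a b \<le> measure lebesgue O'" unfolding m_def
      using lm Olm by (intro measure_mono_fmeasurable) (auto simp: fmeasurableD)
    then have "M * m a b < M * e" using Om M by simp
    moreover have "M * e = \<phi> b - \<phi> a - c' * (b - a)" unfolding e_def using M by simp
    ultimately show False by linarith
  qed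
qed

section \<open>Calculus of directional slope bounds\<close>

text \<open>Only upper bounds are encoded. A lower bound \<open>c\<close> in direction
  \<open>v\<close> is expressed as \<open>slope_le f V (- v) (- c)\<close>, so that one set of rules
  serves both kinds and they can be added to each other.\<close>

definition slope_le :: "('a::real_vector \<Rightarrow> real) \<Rightarrow> 'a set \<Rightarrow> 'a \<Rightarrow> real \<Rightarrow> bool" where
  "slope_le f V v c \<longleftrightarrow>
     (\<forall>y s. 0 < s \<longrightarrow> y \<in> V \<longrightarrow> y + s *\<^sub>R v \<in> V \<longrightarrow> f (y + s *\<^sub>R v) - f y \<le> c * s)"

lemma slope_leD:
  "slope_le f V v c \<Longrightarrow> 0 \<le> s \<Longrightarrow> y \<in> V \<Longrightarrow> y + s *\<^sub>R v \<in> V \<Longrightarrow> f (y + s *\<^sub>R v) - f y \<le> c * s"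
  unfolding slope_le_def by (cases "s = 0") auto

lemma slope_le_mono: "slope_le f U v c \<Longrightarrow> V \<subseteq> U \<Longrightarrow> c \<le> d \<Longrightarrow> slope_le f V v d"
  unfolding slope_le_def
  by (smt (verit, best) mult_right_mono subsetD)

lemma slope_le_scaleR:
  assumes "slope_le f V v c" "r > 0"
  shows "slope_le f V (r *\<^sub>R v) (r * c)"
  unfolding slope_le_def
proof (intro allI impI)
  fix y s assume "0 < (s::real)" "y \<in> V" "y + s *\<^sub>R r *\<^sub>R v \<in> V"
  then show "f (y + s *\<^sub>R r *\<^sub>R v) - f y \<le> r * c * s"
    using slope_leD[OF assms(1), of "s * r" y] assms(2) by (simp add: mult.commute mult.left_commute)
qed

text \<open>A long step along \<open>v\<close> followed by one along \<open>w\<close> may leave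
  \<open>V\<close>. The segment in direction \<open>v + w\<close> stays in \<open>V\<close> by
  convexity, and around each of its points short zigzags stay in the open set \<open>V\<close>;
  subdivision adds up their estimates.\<close>

lemma slope_le_add:
  fixes f :: "'a::real_normed_vector \<Rightarrow> real"
  assumes V: "open V" "convex V" and v: "slope_le f V v c" and w: "slope_le f V w d"
  shows "slope_le f V (v + w) (c + d)"
  unfolding slope_le_def
proof (intro allI impI)
  fix y and s :: real assume s: "0 < s" and y: "y \<in> V" and ys: "y + s *\<^sub>R (v + w) \<in> V"
  define g where "g t = y + t *\<^sub>R (v + w)" for t
  have gV: "g t \<in> V" if "0 \<le> t" "t \<le> s" for t
  proof -
    have "(1 - t/s) *\<^sub>R y + (t/s) *\<^sub>R (y + s *\<^sub>R (v + w)) \<in> V"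
      using convexD[OF V(2) y ys, of "1 - t/s" "t/s"] that s by simp
    moreover have "(1 - t/s) *\<^sub>R y + (t/s) *\<^sub>R (y + s *\<^sub>R (v + w)) = g t"
      using s unfolding g_def by (simp add: algebra_simps)
    ultimately show ?thesis by simp
  qed
  have "0 \<le> (0::real) \<and> s \<le> s \<longrightarrow> f (g s) - f (g 0) \<le> (c + d) * (s - 0)"
  proof (rule Bolzano[of 0 s "\<lambda>t u. 0 \<le> t \<and> u \<le> s \<longrightarrow> f (g u) - f (g t) \<le> (c + d) * (u - t)"])
    fix x :: real assume x: "0 \<le> x" "x \<le> s"
    obtain r where r: "r > 0" "ball (g x) r \<subseteq> V" using gV[OF x] V(1) openE by blast
    \<comment> \<open>The corner of the zigzag from \<open>g t\<close> to \<open>g u\<close> is at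
      distance at most \<open>(u - t) * B\<close> from \<open>g x\<close>.\<close>
    define B where "B = norm (v + w) + norm v + 1"
    have B: "B > 0" unfolding B_def by (simp add: add_nonneg_pos)
    show "\<exists>\<delta>>0. \<forall>t u. t \<le> x \<and> x \<le> u \<and> u - t < \<delta> \<longrightarrow>
        (0 \<le> t \<and> u \<le> s \<longrightarrow> f (g u) - f (g t) \<le> (c + d) * (u - t))"
    proof (intro exI[of _ "r / B"] conjI allI impI)
      fix t u assume tu: "t \<le> x \<and> x \<le> u \<and> u - t < r / B" "0 \<le> t \<and> u \<le> s"
      have gt: "g t \<in> V" and gu: "g u \<in> V" using gV tu by auto
      have "norm ((x - t) *\<^sub>R (v + w) - (u - t) *\<^sub>R v) \<le> (x - t) * norm (v + w) + (u - t) * norm v"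
        using norm_triangle_ineq4[of "(x - t) *\<^sub>R (v + w)" "(u - t) *\<^sub>R v"] tu by simp
      also have "\<dots> \<le> (u - t) * norm (v + w) + (u - t) * norm v"
        using tu by (simp add: mult_right_mono)
      also have "\<dots> \<le> (u - t) * B" unfolding B_def using tu by (simp add: algebra_simps)
      also have "\<dots> < r" using tu B by (simp add: field_simps)
      finally have "g t + (u - t) *\<^sub>R v \<in> V"
        using r(2) by (auto simp: subset_iff dist_norm g_def algebra_simps)
      moreover have "g u = (g t + (u - t) *\<^sub>R v) + (u - t) *\<^sub>R w"
        unfolding g_def by (simp add: algebra_simps)
      ultimately show "f (g u) - f (g t) \<le> (c + d) * (u - t)"
        using slope_leD[OF v, of "u - t" "g t"] slope_leD[OF w, of "u - t" "g t + (u - t) *\<^sub>R v"] gt gu tu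
        unfolding distrib_right by fastforce
    qed (use r B in auto)
  qed (use s in \<open>auto simp: algebra_simps\<close>)
  then show "f (y + s *\<^sub>R (v + w)) - f y \<le> (c + d) * s" unfolding g_def by simp
qed

lemma slope_le_lipschitz:
  fixes f :: "'a::real_normed_vector \<Rightarrow> real"
  assumes "\<And>x y. x \<in> V \<Longrightarrow> y \<in> V \<Longrightarrow> \<bar>f y - f x\<bar> \<le> K * norm (y - x)"
  shows "slope_le f V v (K * norm v)"
  unfolding slope_le_def
proof (intro allI impI)
  fix y s assume "0 < (s::real)" "y \<in> V" "y + s *\<^sub>R v \<in> V"
  then show "f (y + s *\<^sub>R v) - f y \<le> K * norm v * s"
    using assms[of y "y + s *\<^sub>R v"] by (simp add: mult.commute mult.left_commute)
qed

lemma slope_le_sum: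
  fixes f :: "'a::real_normed_vector \<Rightarrow> real"
  assumes "open V" "convex V" "finite I" "\<And>i. i \<in> I \<Longrightarrow> slope_le f V (v i) (c i)"
  shows "slope_le f V (\<Sum>i\<in>I. v i) (\<Sum>i\<in>I. c i)"
  using assms(3,4)
proof (induction I rule: finite_induct)
  case empty
  then show ?case by (simp add: slope_le_def)
next
  case (insert i I)
  then show ?case using slope_le_add[OF assms(1,2)] by simp
qed

section \<open>Frechet derivatives from approximate linearity\<close>

text \<open>The functional \<open>L\<close> may vary with \<open>e\<close>. Functionals for two
  errors approximate the same increments on a common ball, so by homogeneity their distance is at
  most the sum of the errors. They form a Cauchy sequence in the complete dual, and its limit is the
  derivative.\<close>

lemma differentiable_at_if_approximable:
  fixes f :: "'a::banach \<Rightarrow> real"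
  assumes approx: "\<And>e. e > 0 \<Longrightarrow> \<exists>L. bounded_linear L \<and>
      (\<exists>d>0. \<forall>z. norm (z - x) < d \<longrightarrow> \<bar>f z - f x - L (z - x)\<bar> \<le> e * norm (z - x))"
  shows "f differentiable (at x)"
proof -
  let ?A = "\<lambda>L e. \<exists>d>0. \<forall>z. norm (z - x) < d \<longrightarrow>
      \<bar>f z - f x - blinfun_apply L (z - x)\<bar> \<le> e * norm (z - x)"
  define e where "e k = inverse (real (Suc k))" for k
  have e: "e k > 0" for k unfolding e_def by simp
  have "\<exists>L. ?A L (e k)" for k
    using approx[OF e[of k]] bounded_linear_Blinfun_apply by metis
  then obtain L where L: "\<And>k. ?A (L k) (e k)" by metis
  have diff: "norm (L k - L m) \<le> e k + e m" for k m
  proof (rule norm_blinfun_bound)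
    show "0 \<le> e k + e m" using e[of k] e[of m] by simp
    fix h :: 'a
    obtain d1 where d1: "d1 > 0" "\<And>z. norm (z - x) < d1 \<Longrightarrow> \<bar>f z - f x - L k (z - x)\<bar> \<le> e k * norm (z - x)"
      using L by blast
    obtain d2 where d2: "d2 > 0" "\<And>z. norm (z - x) < d2 \<Longrightarrow> \<bar>f z - f x - L m (z - x)\<bar> \<le> e m * norm (z - x)"
      using L by blast
    \<comment> \<open>Scales \<open>h\<close> into both balls; the summand \<open>1\<close> covers
      \<open>h = 0\<close>.\<close>
    define r where "r = min d1 d2 / (norm h + 1)"
    have h1: "norm h + 1 > 0" by (simp add: add_nonneg_pos)
    have r: "r > 0" unfolding r_def using d1 d2 h1 by simp
    have "r * norm h < r * (norm h + 1)" using r by simp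
    also have "\<dots> = min d1 d2" unfolding r_def using h1 by simp
    finally have rh: "norm (r *\<^sub>R h) < d1" "norm (r *\<^sub>R h) < d2" using r by auto
    have "\<bar>L k (r *\<^sub>R h) - L m (r *\<^sub>R h)\<bar> \<le> (e k + e m) * norm (r *\<^sub>R h)"
      using d1(2)[of "x + r *\<^sub>R h"] d2(2)[of "x + r *\<^sub>R h"] rh by (simp add: distrib_right)
    moreover have "L k (r *\<^sub>R h) - L m (r *\<^sub>R h) = r * (L k - L m) h"
      by (simp add: blinfun.scaleR_right blinfun.diff_left right_diff_distrib)
    ultimately have "r * \<bar>(L k - L m) h\<bar> \<le> r * ((e k + e m) * norm h)"
      using r by (simp add: abs_mult mult.left_commute)
    then show "norm ((L k - L m) h) \<le> (e k + e m) * norm h" using r by simp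
  qed
  have e_small: "\<exists>M. \<forall>k\<ge>M. e k < r" if r: "r > 0" for r
  proof -
    obtain M where "e M < r" using reals_Archimedean[OF r] unfolding e_def by blast
    moreover have "e k \<le> e M" if "k \<ge> M" for k unfolding e_def using that by (simp add: le_imp_inverse_le)
    ultimately show ?thesis by (meson order_le_less_trans)
  qed
  have "Cauchy L"
  proof (rule CauchyI)
    fix r :: real assume "0 < r"
    then obtain M where M: "\<And>k. k \<ge> M \<Longrightarrow> e k < r / 2" using e_small[of "r / 2"] by auto
    have "norm (L k - L m) < r" if "k \<ge> M" "m \<ge> M" for k m
      using diff[of k m] M[OF that(1)] M[OF that(2)] by simp
    then show "\<exists>M. \<forall>m\<ge>M. \<forall>n\<ge>M. norm (L m - L n) < r" by blast
  qed
  then obtain L0 where L0: "L \<longlonglongrightarrow> L0" using Cauchy_convergent convergentD by blast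
  have "(f has_derivative L0) (at x)"
    unfolding has_derivative_at_alt
  proof (intro conjI allI impI)
    show "bounded_linear L0" by (rule blinfun.bounded_linear_right)
    fix r :: real assume r: "0 < r"
    obtain M1 where M1: "\<And>k. k \<ge> M1 \<Longrightarrow> e k < r / 2" using e_small[of "r / 2"] r by auto
    obtain M2 where M2: "\<And>k. k \<ge> M2 \<Longrightarrow> norm (L k - L0) < r / 2"
      using LIMSEQ_D[OF L0, of "r / 2"] r by auto
    define k where "k = max M1 M2"
    have k: "e k < r / 2" "norm (L k - L0) < r / 2" unfolding k_def using M1 M2 by auto
    obtain d where d: "d > 0" "\<And>z. norm (z - x) < d \<Longrightarrow> \<bar>f z - f x - L k (z - x)\<bar> \<le> e k * norm (z - x)"
      using L by blast
    have "norm (f z - f x - L0 (z - x)) \<le> r * norm (z - x)" if z: "norm (z - x) < d" for z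
    proof -
      have "\<bar>f z - f x - L0 (z - x)\<bar> \<le> \<bar>f z - f x - L k (z - x)\<bar> + \<bar>(L k - L0) (z - x)\<bar>"
        by (simp add: blinfun.diff_left)
      also have "\<dots> \<le> e k * norm (z - x) + norm (L k - L0) * norm (z - x)"
        using d(2)[OF z] norm_blinfun[of "L k - L0" "z - x"] by simp
      also have "\<dots> = (e k + norm (L k - L0)) * norm (z - x)" by (simp add: distrib_right)
      also have "\<dots> \<le> r * norm (z - x)" using k by (intro mult_right_mono) auto
      finally show ?thesis by simp
    qed
    then show "\<exists>d>0. \<forall>y. norm (y - x) < d \<longrightarrow> norm (f y - f x - L0 (y - x)) \<le> r * norm (y - x)"
      using d(1) by blast
  qed
  then show ?thesis unfolding differentiable_def by blast
qed

section \<open>Lipschitz functions on convex open sets\<close>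

text \<open>The argument repeatedly passes to smaller convex open sets with the same
  \<open>K\<close>, so the results are proved for a variable \<open>U\<close> and interpreted again
  on the subsets. The sign of \<open>K\<close> is left open, which is why norm estimates use its
  absolute value.\<close>

locale lipschitz_convex_open =
  fixes f :: "'a::banach \<Rightarrow> real" and U :: "'a set" and K :: real
  assumes open_U: "open U" and convex_U: "convex U" and nonempty_U: "U \<noteq> {}"
    and lip: "\<And>x y. x \<in> U \<Longrightarrow> y \<in> U \<Longrightarrow> \<bar>f y - f x\<bar> \<le> K * norm (y - x)"
begin

lemma lipschitz_convex_open_subset:
  "open V \<Longrightarrow> convex V \<Longrightarrow> V \<noteq> {} \<Longrightarrow> V \<subseteq> U \<Longrightarrow> lipschitz_convex_open f V K"
  using lip by unfold_locales auto

lemma slope_le_norm: "slope_le f U v (\<bar>K\<bar> * norm v)"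
proof (rule slope_le_mono)
  show "slope_le f U v (K * norm v)" using lip by (rule slope_le_lipschitz)
  show "K * norm v \<le> \<bar>K\<bar> * norm v" by (simp add: mult_right_mono)
qed simp

lemma isCont: "x \<in> U \<Longrightarrow> isCont f x"
proof -
  have "\<bar>K\<bar>-lipschitz_on U f"
  proof (rule lipschitz_onI)
    fix x y assume "x \<in> U" "y \<in> U"
    then have "\<bar>f x - f y\<bar> \<le> K * norm (x - y)" using lip by blast
    also have "\<dots> \<le> \<bar>K\<bar> * norm (x - y)" by (simp add: mult_right_mono)
    finally show "dist (f x) (f y) \<le> \<bar>K\<bar> * dist x y" by (simp add: dist_norm)
  qed auto
  then show "x \<in> U \<Longrightarrow> isCont f x"
    using lipschitz_on_continuous_on open_U continuous_on_eq_continuous_at by blast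
qed

section \<open>From one steep segment to a uniformly steep open set\<close>

text \<open>Lines are represented by base points, so Baire's theorem applies in the space itself.
  Steepness of the whole segment is an open condition on the base point; rational endpoints leave
  countably many candidate parameter intervals; and steepness on one fixed interval passes to limits
  of base points by continuity.\<close>

lemma steep_subset_generic_direction:
  assumes G: "open G" "U \<subseteq> G" and gen: "ess_smooth_generic_lines f G v" and v: "v \<noteq> 0"
    and t: "t > 0" and y: "y \<in> U" "y + t *\<^sub>R v \<in> U" and steep: "c * t < f (y + t *\<^sub>R v) - f y"
  obtains V where "open V" "convex V" "V \<noteq> {}" "V \<subseteq> U" "slope_le f V (- v) (- c)"
proof -
  define S where "S = U \<inter> (\<lambda>a. a + t *\<^sub>R v) -` U"
  define B where "B = S \<inter> (\<lambda>a. f (a + t *\<^sub>R v) - f a) -` {c * t<..}"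
  have "open S" unfolding S_def
    by (intro open_Int open_U open_vimage continuous_intros)
  moreover have "continuous_on S (\<lambda>a. f (a + t *\<^sub>R v) - f a)"
  proof (intro continuous_at_imp_continuous_on ballI)
    fix a assume "a \<in> S"
    then have "isCont f (a + t *\<^sub>R v)" "isCont f a" unfolding S_def by (auto intro: isCont)
    moreover have "isCont (\<lambda>a. a + t *\<^sub>R v) a" by simp
    ultimately show "isCont (\<lambda>a. f (a + t *\<^sub>R v) - f a) a"
      using isCont_o2[where g = f and f = "\<lambda>a. a + t *\<^sub>R v"] isCont_diff by blast
  qed
  ultimately have B_open: "open B" unfolding B_def
    by (intro continuous_open_preimage) auto
  have seg: "a + s *\<^sub>R v \<in> U" if "a \<in> B" "0 \<le> s" "s \<le> t" for a s
  proof -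
    have "(1 - s/t) *\<^sub>R a + (s/t) *\<^sub>R (a + t *\<^sub>R v) \<in> U"
      using that t convexD[OF convex_U, of a "a + t *\<^sub>R v" "1 - s/t" "s/t"]
      unfolding B_def S_def by simp
    moreover have "(1 - s/t) *\<^sub>R a + (s/t) *\<^sub>R (a + t *\<^sub>R v) = a + s *\<^sub>R v"
      using t by (simp add: algebra_simps)
    ultimately show ?thesis by simp
  qed
  define E where "E = (\<lambda>(p, q). {a \<in> B. \<forall>s s'. p < s \<longrightarrow> s < s' \<longrightarrow> s' < q \<longrightarrow>
      c * (s' - s) \<le> f (a + s' *\<^sub>R v) - f (a + s *\<^sub>R v)})"
  define I where "I = {(p, q). p \<in> \<rat> \<and> q \<in> \<rat> \<and> 0 < p \<and> p < q \<and> q < t}"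
  have B_ne: "B \<noteq> {}" unfolding B_def S_def using y steep by auto
  have E_countable: "countable (E ` I)"
  proof -
    have "I \<subseteq> \<rat> \<times> \<rat>" unfolding I_def by auto
    then have "countable I" using countable_rat countable_SIGMA[of "\<rat>" "\<lambda>_. \<rat>"] countable_subset by metis
    then show ?thesis by simp
  qed
  have cover: "B \<subseteq> {a. \<not> ess_smooth_on_line f G a v} \<union> \<Union>(E ` I)"
  proof (intro subsetI UnCI, simp only: mem_Collect_eq)
    fix a assume a: "a \<in> B" and nE: "a \<notin> \<Union>(E ` I)"
    show "\<not> ess_smooth_on_line f G a v"
    proof
      assume ess: "ess_smooth_on_line f G a v"
      define T where "T = {s. a + s *\<^sub>R v \<in> G}"
      have "T = (\<lambda>s. a + s *\<^sub>R v) -` G" unfolding T_def by auto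
      then have T: "open T" using G by (simp add: open_vimage continuous_on_add continuous_on_scaleR)
      have sub: "{0..t} \<subseteq> T" unfolding T_def using seg[OF a] G by auto
      have null: "{s \<in> T. \<not> strictly_differentiable_at (\<lambda>s. f (a + s *\<^sub>R v)) T s} \<in> null_sets lebesgue"
        using ess unfolding ess_smooth_on_line_def T_def Let_def .
      have L: "\<bar>f (a + s' *\<^sub>R v) - f (a + s *\<^sub>R v)\<bar> \<le> (K * norm v) * \<bar>s' - s\<bar>"
        if "s \<in> {0..t}" "s' \<in> {0..t}" for s s'
      proof -
        have "\<bar>f (a + s' *\<^sub>R v) - f (a + s *\<^sub>R v)\<bar> \<le> K * norm ((a + s' *\<^sub>R v) - (a + s *\<^sub>R v))"
          using that by (intro lip seg[OF a]) auto
        also have "(a + s' *\<^sub>R v) - (a + s *\<^sub>R v) = (s' - s) *\<^sub>R v" by (simp add: algebra_simps)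
        finally show ?thesis by (simp add: mult.commute mult.left_commute)
      qed
      have st: "c * (t - 0) < f (a + t *\<^sub>R v) - f (a + 0 *\<^sub>R v)"
        using a unfolding B_def by simp
      obtain z d where zd: "z \<in> {0..t}" "d > 0" "\<And>s s'. z - d < s \<Longrightarrow> s < s' \<Longrightarrow> s' < z + d \<Longrightarrow>
          c * (s' - s) \<le> f (a + s' *\<^sub>R v) - f (a + s *\<^sub>R v)"
        using strictly_differentiable_ae_steep_interval[OF T sub t L null st] by blast
      \<comment> \<open>Even if \<open>z\<close> is an endpoint of \<open>{0..t}\<close>, its
        neighbourhood overlaps the open interval, which leaves room for rational
        \<open>p < q\<close>.\<close>
      have "max 0 (z - d) < min t (z + d)" using zd t by auto
      then obtain p where p: "p \<in> \<rat>" "max 0 (z - d) < p" "p < min t (z + d)"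
        using Rats_dense_in_real by blast
      then obtain q where q: "q \<in> \<rat>" "p < q" "q < min t (z + d)"
        using Rats_dense_in_real by blast
      have "(p, q) \<in> I" unfolding I_def using p q by auto
      moreover have "a \<in> E (p, q)" unfolding E_def using a zd(3) p q by auto
      ultimately show False using nE by blast
    qed
  qed
  have fc: "first_category {a. \<not> ess_smooth_on_line f G a v}"
    using gen unfolding ess_smooth_generic_lines_def .
  obtain F where "F \<in> E ` I" "\<not> nowhere_dense F"
    by (rule open_not_covered_by_nowhere_dense[OF B_open B_ne fc E_countable cover])
  then obtain p q where pq: "(p, q) \<in> I" and nd: "\<not> nowhere_dense (E (p, q))" by auto
  have pq': "0 < p" "p < q" "q < t" using pq unfolding I_def by auto
  have EB: "E (p, q) \<subseteq> B" unfolding E_def by auto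
  \<comment> \<open>On the open set \<open>W\<close> the base points in \<open>E (p, q)\<close> are
    dense, and \<open>B\<close> keeps their segments inside \<open>U\<close>.\<close>
  define W where "W = interior (closure (E (p, q))) \<inter> B"
  have "open W" unfolding W_def using B_open by auto
  have "W \<noteq> {}"
  proof -
    let ?J = "interior (closure (E (p, q)))"
    have "?J \<noteq> {}" using nd unfolding nowhere_dense_def .
    moreover have "?J \<subseteq> closure (E (p, q))" by (rule interior_subset)
    ultimately have "?J \<inter> E (p, q) \<noteq> {}"
      using open_Int_closure_eq_empty[OF open_interior] by (metis inf.absorb_iff1)
    then show ?thesis unfolding W_def using EB by blast
  qed
  then obtain a0 \<rho> where a0: "\<rho> > 0" "ball a0 \<rho> \<subseteq> W" using \<open>open W\<close> openE by blast
  have WE: "c * (s' - s) \<le> f (a + s' *\<^sub>R v) - f (a + s *\<^sub>R v)"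
    if a: "a \<in> W" and s: "p < s" "s < s'" "s' < q" for a s s'
  proof -
    have aB: "a \<in> B" using a unfolding W_def by auto
    have "a \<in> closure (E (p, q))" using a interior_subset unfolding W_def by blast
    then obtain x where x: "\<And>k. x k \<in> E (p, q)" "x \<longlonglongrightarrow> a" unfolding closure_sequential by blast
    have "(\<lambda>k. f (x k + s' *\<^sub>R v) - f (x k + s *\<^sub>R v)) \<longlonglongrightarrow> f (a + s' *\<^sub>R v) - f (a + s *\<^sub>R v)"
      using s pq' seg[OF aB]
      by (intro tendsto_diff isCont_tendsto_compose[where g = f] isCont tendsto_add x(2) tendsto_const) auto
    moreover have "c * (s' - s) \<le> f (x k + s' *\<^sub>R v) - f (x k + s *\<^sub>R v)" for k
      using x(1)[of k] s unfolding E_def by auto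
    ultimately show ?thesis using LIMSEQ_le_const by blast
  qed
  \<comment> \<open>A point \<open>x\<close> of \<open>V\<close> is read as parameter
    \<open>m\<close> on the line with base point \<open>x - m *\<^sub>R v\<close>, which lies in
    \<open>W\<close> since the radius is at most \<open>\<rho>\<close>. The other bound on the
    radius forces a second point of \<open>V\<close> at \<open>x + s *\<^sub>R - v\<close> to have
    parameter \<open>m - s\<close> still above \<open>p\<close>.\<close>
  define m where "m = (p + q) / 2"
  have m: "p < m" "m < q" unfolding m_def using pq' by auto
  define \<sigma> where "\<sigma> = min \<rho> ((m - p) / 2 * norm v)"
  have \<sigma>: "\<sigma> > 0" unfolding \<sigma>_def using a0 m v by simp
  define V where "V = ball (a0 + m *\<^sub>R v) \<sigma>"
  have VW: "x - m *\<^sub>R v \<in> W" if "x \<in> V" for x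
  proof -
    have "x - m *\<^sub>R v \<in> ball a0 \<rho>" using that unfolding V_def \<sigma>_def by (simp add: dist_norm algebra_simps)
    then show ?thesis using a0 by blast
  qed
  show ?thesis
  proof
    show "open V" "convex V" "V \<noteq> {}" unfolding V_def using \<sigma> by auto
    show "V \<subseteq> U"
    proof
      fix x assume "x \<in> V"
      then have "x - m *\<^sub>R v \<in> B" using VW unfolding W_def by blast
      from seg[OF this, of m] show "x \<in> U" using m pq' by simp
    qed
    show "slope_le f V (- v) (- c)"
      unfolding slope_le_def
    proof (intro allI impI)
      fix x and s :: real assume s: "0 < s" and x: "x \<in> V" "x + s *\<^sub>R - v \<in> V"
      have "s * norm v = dist x (x + s *\<^sub>R - v)" using s by (simp add: dist_norm)
      also have "\<dots> < \<sigma> + \<sigma>"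
        using x unfolding V_def mem_ball by (metis add_strict_mono dist_commute dist_triangle_less_add)
      also have "\<dots> \<le> (m - p) * norm v" unfolding \<sigma>_def by (auto simp: min_def)
      finally have "s < m - p" using v by simp
      then have "c * (m - (m - s)) \<le> f ((x - m *\<^sub>R v) + m *\<^sub>R v) - f ((x - m *\<^sub>R v) + (m - s) *\<^sub>R v)"
        using s m by (intro WE VW x(1)) auto
      then show "f (x + s *\<^sub>R - v) - f x \<le> - c * s" by (simp add: algebra_simps)
    qed
  qed
qed

section \<open>The sublinear functional of maximal slopes\<close>

text \<open>This is \<open>p_U\<close> of the overview, taken as the least upper slope bound, so
  that each rule for \<open>slope_le\<close> becomes an inequality for it.\<close>

definition slope_sup :: "'a \<Rightarrow> real" where
  "slope_sup v = Inf {c. slope_le f U v c}"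

text \<open>The infimum is attained because each single quotient is at most every bound. Bounds
  exist by the Lipschitz condition, and they are bounded below because the open set \<open>U\<close>
  contains some segment in direction \<open>v\<close>.\<close>

lemma slope_sup_le_iff: "slope_sup v \<le> c \<longleftrightarrow> slope_le f U v c"
proof -
  let ?C = "{c. slope_le f U v c}"
  obtain y where y: "y \<in> U" using nonempty_U by blast
  obtain r where r: "r > 0" "ball y r \<subseteq> U" using open_U y openE by blast
  define s where "s = r / (norm v + 1)"
  have s: "s > 0" unfolding s_def using r by (simp add: add_nonneg_pos)
  have "s * norm v < s * (norm v + 1)" using s by simp
  also have "\<dots> = r" unfolding s_def using add_nonneg_pos[of "norm v" 1] by simp
  finally have ys: "y + s *\<^sub>R v \<in> U" using r s by (auto simp: subset_iff dist_norm)
  have bdd: "bdd_below ?C"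
  proof (rule bdd_belowI)
    fix c assume "c \<in> ?C"
    then have "f (y + s *\<^sub>R v) - f y \<le> c * s" using slope_leD y ys s by (simp add: slope_le_def)
    then show "(f (y + s *\<^sub>R v) - f y) / s \<le> c" using s by (simp add: field_simps)
  qed
  have ne: "?C \<noteq> {}" using slope_le_norm by blast
  have att: "slope_le f U v (slope_sup v)"
    unfolding slope_le_def
  proof (intro allI impI)
    fix x t assume t: "0 < (t::real)" and x: "x \<in> U" "x + t *\<^sub>R v \<in> U"
    have "(f (x + t *\<^sub>R v) - f x) / t \<le> slope_sup v"
      unfolding slope_sup_def
    proof (rule cInf_greatest[OF ne])
      fix c assume "c \<in> ?C"
      then show "(f (x + t *\<^sub>R v) - f x) / t \<le> c" using t x by (simp add: slope_le_def pos_divide_le_eq)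
    qed
    then show "f (x + t *\<^sub>R v) - f x \<le> slope_sup v * t" using t by (simp add: field_simps)
  qed
  show ?thesis
  proof
    show "slope_sup v \<le> c \<Longrightarrow> slope_le f U v c" using slope_le_mono[OF att] by blast
    show "slope_le f U v c \<Longrightarrow> slope_sup v \<le> c"
      unfolding slope_sup_def using bdd by (simp add: cInf_lower)
  qed
qed

lemma slope_le_slope_sup: "slope_le f U v (slope_sup v)"
  using slope_sup_le_iff by blast

lemma slope_sup_add_norm: "slope_sup v \<le> slope_sup w + \<bar>K\<bar> * norm (v - w)"
  using slope_le_add[OF open_U convex_U slope_le_slope_sup[of w] slope_le_norm[of "v - w"]]
  by (simp add: slope_sup_le_iff)

lemma convex_slope_sup: "convex_on UNIV slope_sup"
proof (rule convex_onI)
  fix t :: real and x y :: 'a assume "0 < t" "t < 1"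
  then show "slope_sup ((1 - t) *\<^sub>R x + t *\<^sub>R y) \<le> (1 - t) * slope_sup x + t * slope_sup y"
    unfolding slope_sup_le_iff
    by (intro slope_le_add open_U convex_U slope_le_scaleR slope_le_slope_sup) auto
qed simp

lemma continuous_slope_sup: "continuous_on UNIV slope_sup"
proof (rule lipschitz_on_continuous_on)
  show "\<bar>K\<bar>-lipschitz_on UNIV slope_sup"
  proof (rule lipschitz_onI)
    fix v w :: 'a
    show "dist (slope_sup v) (slope_sup w) \<le> \<bar>K\<bar> * dist v w"
      using slope_sup_add_norm[of v w] slope_sup_add_norm[of w v]
      by (simp add: dist_norm norm_minus_commute abs_le_iff)
  qed simp
qed

text \<open>The direction \<open>w\<close> is replaced by a multiple of some \<open>v\<close> in
  \<open>D\<close>. The Lipschitz condition charges \<open>\<delta>\<close> for the replacement and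
  \<open>\<delta>\<close> again for the return to \<open>w\<close>.\<close>

lemma steep_subset_direction:
  assumes G: "open G" "U \<subseteq> G" and X: "subspace X" "w \<in> X"
    and D: "D \<subseteq> sphere 0 1" "sphere 0 1 \<inter> X \<subseteq> closure D"
    and gen: "\<And>v. v \<in> D \<Longrightarrow> ess_smooth_generic_lines f G v"
    and c: "c < slope_sup w"
  obtains V where "open V" "convex V" "V \<noteq> {}" "V \<subseteq> U" "slope_le f V (- w) (- c)"
proof (cases "w = 0")
  case True
  have "slope_sup w \<le> 0" unfolding slope_sup_le_iff by (simp add: True slope_le_def)
  then have "slope_le f U (- w) (- c)" using c by (simp add: True slope_le_def mult_nonpos_nonneg)
  then show ?thesis using that open_U convex_U nonempty_U by blast
next
  case False
  define N where "N = norm w"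
  have N: "N > 0" unfolding N_def using False by simp
  have K1: "\<bar>K\<bar> + 1 > 0" by (simp add: add_nonneg_pos)
  \<comment> \<open>Chosen so that the two losses \<open>\<delta>\<close> together stay below
    \<open>slope_sup w - c\<close>; the summand \<open>1\<close> avoids division by zero when
    \<open>K = 0\<close>.\<close>
  define \<eta> where "\<eta> = (slope_sup w - c) / (2 * N * (\<bar>K\<bar> + 1))"
  have \<eta>: "\<eta> > 0" unfolding \<eta>_def using c N K1 by simp
  define \<delta> where "\<delta> = \<bar>K\<bar> * (N * \<eta>)"
  have "2 * \<delta> < 2 * ((\<bar>K\<bar> + 1) * (N * \<eta>))" unfolding \<delta>_def using N \<eta> by simp
  also have "\<dots> = (2 * N * (\<bar>K\<bar> + 1)) * \<eta>" by (simp only: mult_ac)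
  also have "\<dots> = slope_sup w - c"
    unfolding \<eta>_def using N K1 by (intro nonzero_mult_div_cancel_left[THEN trans[OF times_divide_eq_right]]) simp
  finally have \<delta>: "2 * \<delta> < slope_sup w - c" .
  have "(1 / N) *\<^sub>R w \<in> sphere 0 1 \<inter> X"
    using X N by (simp add: N_def subspace_scale)
  then have "(1 / N) *\<^sub>R w \<in> closure D" using D by blast
  then obtain v where v: "v \<in> D" "dist v ((1 / N) *\<^sub>R w) < \<eta>" using \<eta> closure_approachable by blast
  have "N *\<^sub>R v - w = N *\<^sub>R (v - (1 / N) *\<^sub>R w)" using N by (simp add: scaleR_right_diff_distrib)
  then have "norm (N *\<^sub>R v - w) = N * dist v ((1 / N) *\<^sub>R w)" using N by (simp add: dist_norm)
  also have "\<dots> \<le> N * \<eta>" using v N by simp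
  finally have close: "\<bar>K\<bar> * norm (N *\<^sub>R v - w) \<le> \<delta>" unfolding \<delta>_def by (simp add: mult_left_mono)
  have "slope_sup w \<le> slope_sup (N *\<^sub>R v) + \<delta>"
    using slope_sup_add_norm[of w "N *\<^sub>R v"] close by (simp add: norm_minus_commute)
  then have "\<not> slope_le f U (N *\<^sub>R v) (c + \<delta>)" using \<delta> by (simp flip: slope_sup_le_iff)
  then obtain y s where ys: "0 < s" "y \<in> U" "y + (s * N) *\<^sub>R v \<in> U"
      "(c + \<delta>) * s < f (y + (s * N) *\<^sub>R v) - f y"
    unfolding slope_le_def by (auto simp: not_le)
  have "v \<noteq> 0" using D v by auto
  moreover have "s * N > 0" using ys N by simp
  moreover have "(c + \<delta>) / N * (s * N) < f (y + (s * N) *\<^sub>R v) - f y" using ys N by simp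
  ultimately obtain V where V: "open V" "convex V" "V \<noteq> {}" "V \<subseteq> U"
      "slope_le f V (- v) (- ((c + \<delta>) / N))"
    using steep_subset_generic_direction[OF G gen[OF v(1)]] ys by metis
  \<comment> \<open>The directions add up to \<open>- w\<close>, and the bounds to
    \<open>- c\<close>: this is the second payment of \<open>\<delta>\<close>.\<close>
  have "slope_le f V (N *\<^sub>R - v + (N *\<^sub>R v - w)) (N * - ((c + \<delta>) / N) + \<delta>)"
    by (rule slope_le_add[OF V(1,2) slope_le_scaleR[OF V(5) N]
          slope_le_mono[OF slope_le_norm V(4) close]])
  then have "slope_le f V (- w) (- c)" using N by simp
  then show ?thesis using that V by blast
qed

section \<open>Asplund property and approximate linearity\<close>

text \<open>Frechet differentiability, uniform over directions, lets one set \<open>V\<close> serve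
  all \<open>h\<close> at once. Increments of a single size suffice, because slope bounds are
  positively homogeneous.\<close>

lemma small_slopes_subset:
  fixes P :: "'a \<Rightarrow> 'a"
  assumes asp: "asplund TYPE('a)" and P: "bounded_linear P" "range P \<subseteq> X"
    and G: "open G" "U \<subseteq> G" and X: "subspace X"
    and D: "D \<subseteq> sphere 0 1" "sphere 0 1 \<inter> X \<subseteq> closure D"
    and gen: "\<And>v. v \<in> D \<Longrightarrow> ess_smooth_generic_lines f G v"
    and \<epsilon>: "\<epsilon> > 0"
  obtains V L where "open V" "convex V" "V \<noteq> {}" "V \<subseteq> U" "bounded_linear L"
    "\<And>h. slope_le f V (P h) (L h + \<epsilon> * norm h)"
proof -
  let ?g = "\<lambda>x. slope_sup (P x)"
  have lin: "linear P" using P(1) by (rule bounded_linear.linear)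
  have "convex_on UNIV ?g"
  proof (rule convex_onI)
    fix t :: real and x y :: 'a assume "0 < t" "t < 1"
    then show "?g ((1 - t) *\<^sub>R x + t *\<^sub>R y) \<le> (1 - t) * ?g x + t * ?g y"
      using convex_onD[OF convex_slope_sup, of t "P x" "P y"]
      by (simp add: linear_add[OF lin] linear_scale[OF lin])
  qed simp
  moreover have "continuous_on UNIV ?g"
    using continuous_on_compose2[OF continuous_slope_sup linear_continuous_on[OF P(1)]] by simp
  ultimately have "first_category {x. \<not> ?g differentiable (at x)}"
    using asp unfolding asplund_def by blast
  then have "{x. \<not> ?g differentiable (at x)} \<noteq> UNIV"
    using open_not_covered_by_nowhere_dense[of UNIV _ "{}"] by fastforce
  then obtain x0 L where L: "(?g has_derivative L) (at x0)"
    unfolding differentiable_def by blast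
  then have blL: "bounded_linear L" by (rule has_derivative_bounded_linear)
  obtain d where d: "d > 0"
    "\<And>x. norm (x - x0) < d \<Longrightarrow> norm (?g x - ?g x0 - L (x - x0)) \<le> \<epsilon> / 2 * norm (x - x0)"
    using L \<epsilon> unfolding has_derivative_at_alt by (meson half_gt_zero)
  \<comment> \<open>Fixing the size \<open>\<delta>\<close> first allows \<open>c\<close> to fall
    short of the maximal slope by as much as the differentiation error,
    \<open>\<epsilon> / 2 * \<delta>\<close>. Both losses together give
    \<open>\<epsilon> * \<delta>\<close>, and rescaling \<open>k\<close> to \<open>h\<close> turns
    this into \<open>\<epsilon> * norm h\<close>.\<close>
  define \<delta> where "\<delta> = d / 2"
  have \<delta>: "0 < \<delta>" "\<delta> < d" unfolding \<delta>_def using d by auto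
  define c where "c = ?g x0 - \<epsilon> / 2 * \<delta>"
  have "c < ?g x0" unfolding c_def using \<epsilon> \<delta> by simp
  moreover have "P x0 \<in> X" using P by blast
  ultimately obtain V where V: "open V" "convex V" "V \<noteq> {}" "V \<subseteq> U" "slope_le f V (- P x0) (- c)"
    using steep_subset_direction[OF G X _ D gen] by metis
  have "slope_le f V (P h) (L h + \<epsilon> * norm h)" for h
  proof (cases "h = 0")
    case True
    then show ?thesis
      by (simp add: slope_le_def linear_0[OF lin] linear_0[OF bounded_linear.linear[OF blL]])
  next
    case False
    define k where "k = (\<delta> / norm h) *\<^sub>R h"
    have k: "norm k = \<delta>" unfolding k_def using False \<delta> by simp
    have hk: "h = (norm h / \<delta>) *\<^sub>R k" unfolding k_def using False \<delta> by simp
    have "\<bar>?g (x0 + k) - ?g x0 - L k\<bar> \<le> \<epsilon> / 2 * \<delta>"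
      using d(2)[of "x0 + k"] k \<delta> by (simp add: field_simps)
    then have "?g (x0 + k) \<le> ?g x0 + L k + \<epsilon> / 2 * \<delta>" unfolding abs_le_iff by linarith
    then have le: "?g (x0 + k) + - c \<le> L k + \<epsilon> * \<delta>" unfolding c_def by simp
    have "slope_le f V (P (x0 + k) + - P x0) (?g (x0 + k) + - c)"
      by (rule slope_le_add[OF V(1,2) slope_le_mono[OF slope_le_slope_sup V(4) order_refl] V(5)])
    then have "slope_le f V (P k) (L k + \<epsilon> * \<delta>)"
      using slope_le_mono[OF _ order_refl le] by (simp add: linear_add[OF lin])
    then have "slope_le f V ((norm h / \<delta>) *\<^sub>R P k) (norm h / \<delta> * (L k + \<epsilon> * \<delta>))"
      using False \<delta> by (intro slope_le_scaleR) auto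
    moreover have "(norm h / \<delta>) *\<^sub>R P k = P h"
      by (metis hk linear_scale[OF lin])
    moreover have "norm h / \<delta> * L k = L h"
      by (metis hk linear_scale[OF bounded_linear.linear[OF blL]] real_scaleR_def)
    then have "norm h / \<delta> * (L k + \<epsilon> * \<delta>) = L h + \<epsilon> * norm h"
      using \<delta> by (simp add: distrib_left)
    ultimately show ?thesis by simp
  qed
  then show ?thesis using that V blL by blast
qed

text \<open>Slope bounds survive shrinking the set, so the summands can be treated one after
  another, each with error share \<open>\<epsilon> / n\<close>. Decomposing a vector by the
  projections and adding the bounds covers all directions.\<close>

lemma almost_linear_subset:
  fixes n :: nat
  assumes asp: "asplund TYPE('a)" and G: "open G" "U \<subseteq> G"
    and n: "n \<ge> 1" and decomp: "direct_sum_decomp n Xs"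
    and D_dense: "\<forall>i\<in>{1..n}. D i \<subseteq> sphere 0 1 \<inter> Xs i \<and> sphere 0 1 \<inter> Xs i \<subseteq> closure (D i)
           \<and> (\<forall>v\<in>D i. ess_smooth_generic_lines f G v)"
    and \<epsilon>: "\<epsilon> > 0"
  obtains V L where "open V" "V \<noteq> {}" "V \<subseteq> U" "bounded_linear L"
    "\<And>y z. y \<in> V \<Longrightarrow> z \<in> V \<Longrightarrow> \<bar>f z - f y - L (z - y)\<bar> \<le> \<epsilon> * norm (z - y)"
proof -
  have "\<exists>P :: nat \<Rightarrow> 'a \<Rightarrow> 'a. (\<forall>i\<in>{1..n}. bounded_linear (P i) \<and> (\<forall>x. P i x \<in> Xs i)) \<and>
      (\<forall>x. x = (\<Sum>i=1..n. P i x))"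
    using decomp unfolding direct_sum_decomp_def by (elim conjE)
  then obtain P :: "nat \<Rightarrow> 'a \<Rightarrow> 'a"
    where P': "\<forall>i\<in>{1..n}. bounded_linear (P i) \<and> (\<forall>x. P i x \<in> Xs i)" "\<forall>x. x = (\<Sum>i=1..n. P i x)"
    by (elim exE conjE)
  have P: "\<And>i. i \<in> {1..n} \<Longrightarrow> bounded_linear (P i)" "\<And>i x. i \<in> {1..n} \<Longrightarrow> P i x \<in> Xs i"
    using P'(1) by blast+
  have X: "\<And>i. i \<in> {1..n} \<Longrightarrow> subspace (Xs i)"
    using decomp[unfolded direct_sum_decomp_def, THEN conjunct1] by blast
  have D: "\<And>i. i \<in> {1..n} \<Longrightarrow> D i \<subseteq> sphere 0 1" "\<And>i. i \<in> {1..n} \<Longrightarrow> sphere 0 1 \<inter> Xs i \<subseteq> closure (D i)"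
    "\<And>i v. i \<in> {1..n} \<Longrightarrow> v \<in> D i \<Longrightarrow> ess_smooth_generic_lines f G v"
    using D_dense by auto
  have "\<exists>V L. open V \<and> convex V \<and> V \<noteq> {} \<and> V \<subseteq> U \<and>
      (\<forall>i\<in>{1..k}. bounded_linear (L i) \<and> (\<forall>h. slope_le f V (P i h) (L i h + \<epsilon> / n * norm h)))"
    if "k \<le> n" for k
    using that
  proof (induction k)
    case 0
    then show ?case using open_U convex_U nonempty_U by auto
  next
    case (Suc k)
    then obtain V L where V: "open V" "convex V" "V \<noteq> {}" "V \<subseteq> U"
      and L: "\<And>i. i \<in> {1..k} \<Longrightarrow> bounded_linear (L i)"
        "\<And>i h. i \<in> {1..k} \<Longrightarrow> slope_le f V (P i h) (L i h + \<epsilon> / n * norm h)"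
      using Suc_leD by blast
    interpret V: lipschitz_convex_open f V K by (rule lipschitz_convex_open_subset[OF V])
    have k: "Suc k \<in> {1..n}" using Suc.prems by simp
    have "\<epsilon> / n > 0" using \<epsilon> n by simp
    moreover have "range (P (Suc k)) \<subseteq> Xs (Suc k)" using P(2)[OF k] by blast
    moreover have "V \<subseteq> G" using V G by blast
    ultimately obtain W M where W: "open W" "convex W" "W \<noteq> {}" "W \<subseteq> V" "bounded_linear M"
        "\<And>h. slope_le f W (P (Suc k) h) (M h + \<epsilon> / n * norm h)"
      using V.small_slopes_subset[OF asp P(1)[OF k] _ G(1) _ X[OF k] D(1)[OF k] D(2)[OF k] D(3)[OF k]]
      by metis
    show ?case
    proof (intro exI[of _ W] exI[of _ "L(Suc k := M)"] conjI ballI allI)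
      fix i h assume "i \<in> {1..Suc k}"
      then have i: "i = Suc k \<or> i \<in> {1..k} \<and> i \<noteq> Suc k" by auto
      then show "bounded_linear ((L(Suc k := M)) i)" using W L by auto
      show "slope_le f W (P i h) ((L(Suc k := M)) i h + \<epsilon> / n * norm h)"
        using i W(6) slope_le_mono[OF L(2) W(4) order_refl] by auto
    qed (use W V in auto)
  qed
  from this[OF order_refl] obtain V L where V: "open V" "convex V" "V \<noteq> {}" "V \<subseteq> U"
    and L: "\<And>i. i \<in> {1..n} \<Longrightarrow> bounded_linear (L i)"
      "\<And>i h. i \<in> {1..n} \<Longrightarrow> slope_le f V (P i h) (L i h + \<epsilon> / n * norm h)" by blast
  define L0 where "L0 h = (\<Sum>i=1..n. L i h)" for h
  have blL0: "bounded_linear L0" unfolding L0_def using L by (intro bounded_linear_sum) auto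
  have sl: "slope_le f V h (L0 h + \<epsilon> * norm h)" for h
  proof -
    have "slope_le f V (\<Sum>i=1..n. P i h) (\<Sum>i=1..n. L i h + \<epsilon> / n * norm h)"
      using V L by (intro slope_le_sum) auto
    then show ?thesis unfolding P'(2)[rule_format, of h, symmetric] using n by (simp add: sum.distrib L0_def)
  qed
  have le: "f z - f y \<le> L0 (z - y) + \<epsilon> * norm (z - y)" if "y \<in> V" "z \<in> V" for y z
    using slope_leD[OF sl[of "z - y"], of 1 y] that by simp
  \<comment> \<open>The upper bound alone suffices: exchanging \<open>y\<close> and \<open>z\<close>
    gives the lower one, since \<open>L0\<close> is linear.\<close>
  have "\<bar>f z - f y - L0 (z - y)\<bar> \<le> \<epsilon> * norm (z - y)" if "y \<in> V" "z \<in> V" for y z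
    using le[OF that] le[OF that(2,1)] linear_diff[OF bounded_linear.linear[OF blL0], of z y]
      linear_diff[OF bounded_linear.linear[OF blL0], of y z]
    by (simp add: abs_le_iff norm_minus_commute)
  then show ?thesis using that V blL0 by blast
qed

end

section \<open>Residuality of the set of differentiability points\<close>

theorem mainTheorem17:
  fixes f :: "'a::banach \<Rightarrow> real" and G :: "'a set"
    and n :: nat and Xs :: "nat \<Rightarrow> 'a set" and D :: "nat \<Rightarrow> 'a set"
  assumes "n \<ge> 1"
    and "direct_sum_decomp n Xs"
    and "asplund TYPE('a)"
    and "open G"
    and "locally_lipschitz_on G f"
    and "\<forall>i\<in>{1..n}. D i \<subseteq> sphere 0 1 \<inter> Xs i \<and> sphere 0 1 \<inter> Xs i \<subseteq> closure (D i)
           \<and> (\<forall>v\<in>D i. ess_smooth_generic_lines f G v)"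
  shows "residual_in {x \<in> G. f differentiable (at x)} G"
proof -
  \<comment> \<open>The functional depends on \<open>V\<close> and \<open>\<epsilon>\<close> but not
    on a point of \<open>V\<close>. A point in every \<open>W k\<close> thus has neighbourhoods of
    approximate linearity for all errors.\<close>
  define good where "good \<epsilon> V \<longleftrightarrow> open V \<and> (\<exists>L. bounded_linear L \<and>
      (\<forall>y\<in>V. \<forall>z\<in>V. \<bar>f z - f y - L (z - y)\<bar> \<le> \<epsilon> * norm (z - y)))" for \<epsilon> V
  define W where "W k = \<Union>{V. good (inverse (real (Suc k))) V}" for k
  have dense: "\<exists>V. V \<noteq> {} \<and> V \<subseteq> O' \<and> good \<epsilon> V" if O: "open O'" "O' \<inter> G \<noteq> {}" and \<epsilon>: "\<epsilon> > 0" for O' \<epsilon>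
  proof -
    obtain x where x: "x \<in> O'" "x \<in> G" using O by blast
    from assms(5)[unfolded locally_lipschitz_on_def, rule_format, OF x(2)]
    obtain r K where r: "r > 0"
      "\<And>y z. y \<in> ball x r \<inter> G \<Longrightarrow> z \<in> ball x r \<inter> G \<Longrightarrow> \<bar>f y - f z\<bar> \<le> K * dist y z"
      by blast
    obtain d where d: "d > 0" "ball x d \<subseteq> O' \<inter> G" using O assms(4) x openE by (metis IntI open_Int)
    let ?U = "ball x (min r d)"
    have U: "?U \<subseteq> O'" "?U \<subseteq> G" "?U \<subseteq> ball x r" using d by auto
    interpret lipschitz_convex_open f ?U K
    proof
      show "\<bar>f z - f y\<bar> \<le> K * norm (z - y)" if "y \<in> ?U" "z \<in> ?U" for y z
        using r(2)[of z y] that U unfolding dist_norm by blast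
    qed (use r d in auto)
    obtain V L where "open V" "V \<noteq> {}" "V \<subseteq> ?U" "bounded_linear L"
      "\<And>y z. y \<in> V \<Longrightarrow> z \<in> V \<Longrightarrow> \<bar>f z - f y - L (z - y)\<bar> \<le> \<epsilon> * norm (z - y)"
      using almost_linear_subset[OF assms(3,4) U(2) assms(1,2,6) \<epsilon>] by metis
    then show ?thesis unfolding good_def using U by blast
  qed
  have "nowhere_dense (G - W k)" for k
  proof -
    let ?J = "interior (closure (G - W k))"
    have "?J = {}"
    proof (rule ccontr)
      assume "?J \<noteq> {}"
      moreover have "?J \<subseteq> closure (G - W k)" by (rule interior_subset)
      ultimately have "?J \<inter> (G - W k) \<noteq> {}"
        using open_Int_closure_eq_empty[OF open_interior] by (metis inf.absorb_iff1)
      \<comment> \<open>\<open>J\<close> meets \<open>G\<close>, so it contains a nonempty good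
        \<open>V\<close>. This \<open>V\<close> is open and part of \<open>W k\<close>, hence misses
        the closure of \<open>G - W k\<close>, although \<open>J\<close> lies inside that
        closure.\<close>
      then obtain V where V: "V \<noteq> {}" "V \<subseteq> ?J" "good (inverse (real (Suc k))) V"
        using dense[of ?J "inverse (real (Suc k))"] by auto
      then have "open V" "V \<inter> (G - W k) = {}" unfolding W_def good_def by blast+
      then have "V \<inter> closure (G - W k) = {}" by (simp add: open_Int_closure_eq_empty)
      then show False using V interior_subset by blast
    qed
    then show ?thesis unfolding nowhere_dense_def .
  qed
  moreover have "G - {x \<in> G. f differentiable (at x)} \<subseteq> (\<Union>k. G - W k)"
  proof -
    have "f differentiable (at x)" if x: "\<And>k. x \<in> W k" for x
    proof (rule differentiable_at_if_approximable)
      fix e :: real assume "e > 0"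
      then obtain k where k: "inverse (real (Suc k)) < e" using reals_Archimedean by blast
      obtain V where V: "x \<in> V" "good (inverse (real (Suc k))) V" using x[of k] unfolding W_def by blast
      then obtain L where L: "bounded_linear L"
        "\<And>z. z \<in> V \<Longrightarrow> \<bar>f z - f x - L (z - x)\<bar> \<le> inverse (real (Suc k)) * norm (z - x)"
        unfolding good_def by blast
      obtain d where d: "d > 0" "ball x d \<subseteq> V" using V openE unfolding good_def by blast
      have "\<bar>f z - f x - L (z - x)\<bar> \<le> e * norm (z - x)" if "norm (z - x) < d" for z
      proof -
        have "z \<in> V" using that d by (auto simp: subset_iff dist_norm norm_minus_commute)
        moreover have "inverse (real (Suc k)) * norm (z - x) \<le> e * norm (z - x)"
          using k by (intro mult_right_mono) auto
        ultimately show ?thesis using L(2) order_trans by blast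
      qed
      then show "\<exists>L. bounded_linear L \<and>
          (\<exists>d>0. \<forall>z. norm (z - x) < d \<longrightarrow> \<bar>f z - f x - L (z - x)\<bar> \<le> e * norm (z - x))"
        using L(1) d(1) by blast
    qed
    then show ?thesis by blast
  qed
  ultimately show ?thesis unfolding residual_in_def first_category_def
    by (intro exI[of _ "\<lambda>k. G - W k"]) simp
qed

end
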